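(* Let $a_n=\binom{2n}{n}^2$ for $n\ge 0$. Then for each $k\in\mathbb{N}$, $$\mathcal{M}^{(k)}_n(\boldsymbol{a}) \sim \frac{e^{4n\ln 2}}{n\pi}\left(\frac{\ln n}{\pi}\right)^{k-1} k\quad\text{as } n\to\infty.$$ Moreover, let $\mathbf{P}^{\mathrm{2SRWB}}_n$ (expectation $\mathbf{E}^{\mathrm{2SRWB}}_n$) be the law of two independent uniformly random simple random walk bridges of length $2n$, $(x^{(i)}_0,\dots,x^{(i)}_{2n})$, $i=1,2$ (each with $x^{(i)}_0=0$, steps $\pm1$, $x^{(i)}_{2n}=0$), and let $\mathfrak{Z}_n = \{0\}\cup\{t\in\{1,\dots,n\}: x^{(1)}_{2t}=x^{(2)}_{2t}=0\}$. Then for each $k\in\mathbb{N}$, $$\lim_{n\to\infty}\mathbf{E}^{\mathrm{2SRWB}}_n\left[\left(\frac{\pi}{\ln n}|\mathfrak{Z}_n|\right)^k\right] = (k+1)!.$$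
   Context: For a sequence $\boldsymbol{a}=(a_n)_{n\ge 0}$ and $k\in\mathbb{N}$, the $k$-fold convolution is $\mathcal{M}^{(k)}_n(\boldsymbol{a}) = \sum_{j_1,\dots,j_k\ge 0,\ j_1+\dots+j_k=n} a_{j_1}\cdots a_{j_k}$. *)

theory Defs
  imports
    "HOL-Probability.Probability"
    "HOL-Computational_Algebra.Formal_Power_Series"
    "HOL-Library.Landau_Symbols"
begin

(* natpermute n k is the (finite) set of all lists of k natural numbers with sum n. *)
definition conv_power :: "nat \<Rightarrow> (nat \<Rightarrow> 'a::comm_semiring_1) \<Rightarrow> nat \<Rightarrow> 'a" where
  "conv_power k a n = (\<Sum>js\<in>natpermute n k. \<Prod>i<k. a (js ! i))"

(* The list x represents the path (x ! 0, ..., x ! (2 * n)). *)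
definition srw_bridges :: "nat \<Rightarrow> int list set" where
  "srw_bridges n =
     {x. length x = 2 * n + 1 \<and> x ! 0 = 0 \<and> x ! (2 * n) = 0 \<and>
         (\<forall>i<2 * n. x ! Suc i - x ! i \<in> {-1, 1})}"

lemma finite_srw_bridges: "finite (srw_bridges n)"
proof (rule finite_subset)
  show "srw_bridges n \<subseteq> {x. set x \<subseteq> {-int (2 * n)..int (2 * n)} \<and> length x = 2 * n + 1}"
  proof
    fix x assume x: "x \<in> srw_bridges n"
    have bound: "\<bar>x ! i\<bar> \<le> int i" if "i \<le> 2 * n" for i
      using that
    proof (induction i)
      case 0
      then show ?case using x by (simp add: srw_bridges_def)
    next
      case (Suc i)
      then have "x ! Suc i - x ! i \<in> {-1, 1}"
        using x by (simp add: srw_bridges_def)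
      moreover have "\<bar>x ! i\<bar> \<le> int i"
        using Suc by simp
      ultimately show ?case by auto
    qed
    have len: "length x = 2 * n + 1"
      using x by (simp add: srw_bridges_def)
    have "y \<in> {-int (2 * n)..int (2 * n)}" if "y \<in> set x" for y
    proof -
      obtain i where "i < length x" "y = x ! i"
        using \<open>y \<in> set x\<close> by (metis in_set_conv_nth)
      then show ?thesis using bound[of i] len by simp linarith
    qed
    then show "x \<in> {x. set x \<subseteq> {-int (2 * n)..int (2 * n)} \<and> length x = 2 * n + 1}"
      using len by blast
  qed
  show "finite {x. set x \<subseteq> {-int (2 * n)..int (2 * n)} \<and> length x = 2 * n + 1}"
    by (rule finite_lists_length_eq) simp
qed

lemma srw_bridges_nonempty: "srw_bridges n \<noteq> {}"
proof -
  have "map (\<lambda>i. int (i mod 2)) [0..<2 * n + 1] \<in> srw_bridges n"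
    by (simp add: srw_bridges_def mod_Suc del: upt_Suc)
  then show ?thesis by blast
qed

definition two_srw_bridges :: "nat \<Rightarrow> (int list \<times> int list) pmf" where
  "two_srw_bridges n =
     pair_pmf (pmf_of_set (srw_bridges n)) (pmf_of_set (srw_bridges n))"

definition common_zeros :: "nat \<Rightarrow> int list \<times> int list \<Rightarrow> nat set" where
  "common_zeros n x =
     {0} \<union> {t \<in> {1..n}. fst x ! (2 * t) = 0 \<and> snd x ! (2 * t) = 0}"

end

theory Submission
  imports Defs "HOL-Combinatorics.Stirling" "HOL-Real_Asymp.Real_Asymp"
begin

text \<open>
  Let \<open>B(x) = \<Sum> b\<^sub>n x\<^sup>n\<close> with \<open>b\<^sub>n = a\<^sub>n / 16\<^sup>n\<close>. Wallis' product gives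
  \<open>1 / (\<pi> (n + 1)) \<le> b\<^sub>n \<le> 1 / (\<pi> n)\<close>, so the partial sums of \<open>b\<close> are \<open>ln n / \<pi> + O(1)\<close>, and
  those of the coefficients of \<open>B(x)\<^sup>k\<close> lie between the \<open>k\<close>-th powers of the partial sums of \<open>b\<close>
  up to \<open>n div k\<close> and up to \<open>n\<close>. Comparing coefficients in \<open>x (B\<^sup>k)' = k (x B') B\<^sup>k\<^sup>-\<^sup>1\<close>, where the
  coefficients \<open>n b\<^sub>n\<close> of \<open>x B'\<close> tend to \<open>1 / \<pi>\<close>, then yields the asymptotics of the convolution powers.

  For the moments, cutting a pair of bridges at a weakly increasing \<open>k\<close>-tuple of common zeros leaves
  \<open>k + 1\<close> pairs of bridges. There are \<open>pochhammer |Z| k / k!\<close> such tuples, so the rising factorial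
  moments are ratios of convolution powers; Stirling numbers convert them to ordinary moments,
  the lower-order terms being negligible.
\<close>

section \<open>Coefficients and partial sums of products and powers of formal power series\<close>

lemma fps_nth_power_nonneg:
  fixes F :: "'a::linordered_idom fps"
  assumes "\<And>i. fps_nth F i \<ge> 0"
  shows "fps_nth (F ^ k) i \<ge> 0"
proof (induction k arbitrary: i)
  case (Suc k)
  then show ?case
    by (auto simp: fps_mult_nth intro!: sum_nonneg mult_nonneg_nonneg assms)
qed auto

lemma sum_fps_nth_mult:
  fixes F G :: "'a::comm_semiring_1 fps"
  shows "(\<Sum>i\<le>n. fps_nth (F * G) i) = (\<Sum>(i,j)\<in>{(i,j). i + j \<le> n}. fps_nth F i * fps_nth G j)"
  by (subst sum.triangle_reindex_eq) (simp add: fps_mult_nth atLeast0AtMost)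

lemma finite_triangle: "finite {(i,j). i + j \<le> (n::nat)}"
  by (rule finite_subset[of _ "{..n} \<times> {..n}"]) auto

text \<open>The triangle \<open>i + j \<le> n\<close> lies in the square
  \<open>{..n} \<times> {..n}\<close>, and by nonnegativity the additional terms only increase the
  sum.\<close>

lemma sum_fps_nth_mult_le:
  fixes F G :: "'a::linordered_idom fps"
  assumes "\<And>i. fps_nth F i \<ge> 0" "\<And>i. fps_nth G i \<ge> 0"
  shows "(\<Sum>i\<le>n. fps_nth (F * G) i) \<le> (\<Sum>i\<le>n. fps_nth F i) * (\<Sum>i\<le>n. fps_nth G i)"
  unfolding sum_fps_nth_mult sum_product sum.cartesian_product
  by (intro sum_mono2) (auto simp: assms)

text \<open>Here the rectangle \<open>{..l} \<times> {..m}\<close> lies in the triangle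
  \<open>i + j \<le> n\<close>.\<close>

lemma sum_fps_nth_mult_ge:
  fixes F G :: "'a::linordered_idom fps"
  assumes "\<And>i. fps_nth F i \<ge> 0" "\<And>i. fps_nth G i \<ge> 0" "l + m \<le> n"
  shows "(\<Sum>i\<le>l. fps_nth F i) * (\<Sum>i\<le>m. fps_nth G i) \<le> (\<Sum>i\<le>n. fps_nth (F * G) i)"
  unfolding sum_fps_nth_mult sum_product sum.cartesian_product
  by (intro sum_mono2 finite_triangle) (use assms in auto)

lemma sum_fps_nth_power_le:
  fixes F :: "'a::linordered_idom fps"
  assumes "\<And>i. fps_nth F i \<ge> 0"
  shows "(\<Sum>i\<le>n. fps_nth (F ^ k) i) \<le> (\<Sum>i\<le>n. fps_nth F i) ^ k"
proof (induction k)
  case (Suc k)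
  have "(\<Sum>i\<le>n. fps_nth (F * F ^ k) i) \<le> (\<Sum>i\<le>n. fps_nth F i) * (\<Sum>i\<le>n. fps_nth (F ^ k) i)"
    by (intro sum_fps_nth_mult_le fps_nth_power_nonneg assms)
  also have "\<dots> \<le> (\<Sum>i\<le>n. fps_nth F i) * (\<Sum>i\<le>n. fps_nth F i) ^ k"
    by (intro mult_left_mono Suc sum_nonneg assms)
  finally show ?case by simp
qed (simp add: sum.delta)

text \<open>Any \<open>k\<close> indices that are at most \<open>m\<close> have sum at most
  \<open>k * m \<le> n\<close>, so every product in the expanded left side is also counted on the
  right.\<close>

lemma sum_fps_nth_power_ge:
  fixes F :: "'a::linordered_idom fps"
  assumes "\<And>i. fps_nth F i \<ge> 0" "k * m \<le> n"
  shows "(\<Sum>i\<le>m. fps_nth F i) ^ k \<le> (\<Sum>i\<le>n. fps_nth (F ^ k) i)"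
  using assms(2)
proof (induction k arbitrary: n)
  case (Suc k)
  have "(\<Sum>i\<le>m. fps_nth F i) ^ Suc k \<le> (\<Sum>i\<le>m. fps_nth F i) * (\<Sum>i\<le>k*m. fps_nth (F ^ k) i)"
    unfolding power_Suc by (intro mult_left_mono Suc.IH order_refl sum_nonneg assms)
  also have "\<dots> \<le> (\<Sum>i\<le>n. fps_nth (F * F ^ k) i)"
    using Suc.prems by (intro sum_fps_nth_mult_ge fps_nth_power_nonneg assms) auto
  finally show ?case by simp
qed (simp add: sum.delta)

text \<open>This compares coefficients in x (F^k)' = k (x F') F^(k-1). For \<open>k = 0\<close> the
  factor \<open>of_nat k\<close> makes the truncated \<open>k - 1\<close> harmless.\<close>

lemma fps_nth_power_deriv:
  fixes F :: "'a::comm_ring_1 fps"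
  shows "of_nat n * fps_nth (F ^ k) n =
    of_nat k * (\<Sum>i\<le>n. of_nat i * fps_nth F i * fps_nth (F ^ (k - 1)) (n - i))"
proof (cases n)
  case (Suc m)
  have "of_nat n * fps_nth (F ^ k) n = fps_nth (fps_deriv (F ^ k)) m"
    by (simp add: Suc)
  also have "\<dots> = of_nat k * fps_nth (fps_deriv F * F ^ (k - 1)) m"
    unfolding fps_deriv_power mult.assoc by simp
  also have "fps_nth (fps_deriv F * F ^ (k - 1)) m =
      (\<Sum>i\<le>m. of_nat (Suc i) * fps_nth F (Suc i) * fps_nth (F ^ (k - 1)) (m - i))"
    by (simp add: fps_mult_nth atLeast0AtMost)
  also have "\<dots> = (\<Sum>i\<le>n. of_nat i * fps_nth F i * fps_nth (F ^ (k - 1)) (n - i))"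
    by (simp add: Suc sum.atMost_Suc_shift del: sum.atMost_Suc of_nat_Suc)
  finally show ?thesis .
qed simp

lemma conv_power_eq_fps_nth:
  fixes f :: "nat \<Rightarrow> 'a::comm_ring_1"
  shows "conv_power k f n = fps_nth (Abs_fps f ^ k) n"
proof (cases k)
  case 0
  then show ?thesis by (simp add: conv_power_def natpermute_0)
next
  case (Suc m)
  then show ?thesis
    by (simp add: conv_power_def fps_power_nth_Suc atLeast0AtMost lessThan_Suc_atMost del: power_Suc)
qed

lemma fps_nth_power_scaled:
  fixes f :: "nat \<Rightarrow> 'a::idom"
  shows "fps_nth (Abs_fps (\<lambda>i. c ^ i * f i) ^ k) n = c ^ n * fps_nth (Abs_fps f ^ k) n"
proof -
  have "Abs_fps (\<lambda>i. c ^ i * f i) = fps_compose (Abs_fps f) (fps_const c * fps_X)"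
    by (simp add: fps_eq_iff)
  then have "Abs_fps (\<lambda>i. c ^ i * f i) ^ k = fps_compose (Abs_fps f ^ k) (fps_const c * fps_X)"
    by (simp add: fps_compose_power)
  then show ?thesis
    by simp
qed

section \<open>Return probabilities of two independent walks to the origin, bounded via Wallis'
  product\<close>

definition central_prob :: "nat \<Rightarrow> real" where
  "central_prob n = (real ((2 * n) choose n))\<^sup>2 / 16 ^ n"

lemma central_prob_0 [simp]: "central_prob 0 = 1"
  by (simp add: central_prob_def)

lemma central_prob_pos: "central_prob n > 0"
  by (simp add: central_prob_def)

lemma central_prob_Suc:
  "central_prob (Suc n) = central_prob n * ((2 * real n + 1) / (2 * real n + 2))\<^sup>2"
proof -
  have "real ((2 * Suc n) choose Suc n) = real ((2 * n) choose n) * (4 * (2 * real n + 1) / (2 * real n + 2))"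
  proof -
    have "real ((2 * Suc n) choose Suc n) = fact (2 * n + 2) / (fact (n + 1) * fact (n + 1))"
      by (subst binomial_fact) (auto simp: field_simps)
    moreover have "real ((2 * n) choose n) = fact (2 * n) / (fact n * fact n)"
      by (subst binomial_fact) (auto simp: field_simps)
    ultimately show ?thesis
      by (simp only:) (simp add: divide_simps, simp add: algebra_simps)
  qed
  moreover have "4 * (2 * real n + 1) / (2 * real n + 2) = 4 * ((2 * real n + 1) / (2 * real n + 2))"
    by simp
  ultimately show ?thesis
    unfolding central_prob_def power_Suc by (simp only: power_mult_distrib) simp
qed

text \<open>From \<open>n\<close> to \<open>n + 1\<close> both sides gain the factor 4(n+1)^2 /
  ((2n+1)(2n+3)). Wallis' limit thereby becomes a limit for \<open>central_prob\<close>.\<close>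

lemma wallis_product_eq:
  "(\<Prod>k=1..n. (4*real k^2) / (4*real k^2 - 1)) = 1 / ((2 * real n + 1) * central_prob n)"
proof (induction n)
  case (Suc n)
  have *: "4 * (real (Suc n))\<^sup>2 - 1 = (2 * real n + 1) * (2 * real n + 3)"
    by (simp add: power2_eq_square algebra_simps)
  have "(\<Prod>k=1..Suc n. (4*real k^2) / (4*real k^2 - 1)) =
      1 / ((2 * real n + 1) * central_prob n) * ((4*real (Suc n)^2) / ((2 * real n + 1) * (2 * real n + 3)))"
    unfolding Suc.IH[symmetric] *[symmetric] by (simp add: prod.nat_ivl_Suc' mult.commute)
  also have "\<dots> = 1 / ((2 * real (Suc n) + 1) * central_prob (Suc n))"
    using central_prob_pos[of n]
    by (simp add: central_prob_Suc divide_simps) (simp add: power2_eq_square algebra_simps)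
  finally show ?case .
qed simp

lemma tendsto_central_prob: "(\<lambda>n. (2 * real n + 1) * central_prob n) \<longlonglongrightarrow> 2 / pi"
proof -
  have "(\<lambda>n. 1 / (\<Prod>k=1..n. (4*real k^2) / (4*real k^2 - 1))) \<longlonglongrightarrow> 1 / (pi / 2)"
    by (intro tendsto_intros wallis) auto
  then show ?thesis
    unfolding wallis_product_eq by simp
qed

text \<open>Since (2n+3)(2n+1) \<le> (2n+2)^2, the sequence (2n+1) b_n decreases to its limit 2/pi
  and stays above it. Enlarging 2n+1 to 2n+2 gives the stated form.\<close>

lemma central_prob_ge: "central_prob n \<ge> 1 / (pi * (real n + 1))"
proof -
  have "decseq (\<lambda>n. (2 * real n + 1) * central_prob n)"
  proof (rule decseq_SucI)
    fix n
    have "(2 * real (Suc n) + 1) * central_prob (Suc n) =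
        (2 * real n + 1) * central_prob n * ((2 * real n + 3) * (2 * real n + 1) / (2 * real n + 2)\<^sup>2)"
      by (simp add: central_prob_Suc divide_simps power2_eq_square)
    also have "\<dots> \<le> (2 * real n + 1) * central_prob n * 1"
    proof (intro mult_left_mono)
      have "(2 * real n + 3) * (2 * real n + 1) \<le> (2 * real n + 2)\<^sup>2"
        by (simp add: power2_eq_square algebra_simps)
      then show "(2 * real n + 3) * (2 * real n + 1) / (2 * real n + 2)\<^sup>2 \<le> 1"
        by (simp add: divide_le_eq_1)
    qed (use central_prob_pos[of n] in auto)
    finally show "(2 * real (Suc n) + 1) * central_prob (Suc n) \<le> (2 * real n + 1) * central_prob n"
      by simp
  qed
  from decseq_ge[OF this tendsto_central_prob, of n]
  have "2 / pi \<le> (2 * real n + 1) * central_prob n" .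
  also have "\<dots> \<le> (2 * real n + 2) * central_prob n"
    using central_prob_pos[of n] by (intro mult_right_mono) auto
  finally have "2 / pi \<le> 2 * (central_prob n * (real n + 1))"
    by (simp add: algebra_simps)
  then have "1 / pi / (real n + 1) \<le> central_prob n"
    by (subst pos_divide_le_eq) auto
  then show ?thesis
    by simp
qed

text \<open>Since (2n+1)^2 \<ge> 4n(n+1), the sequence n b_n increases to its limit 1/pi and stays
  below it.\<close>

lemma central_prob_le: "real n * central_prob n \<le> 1 / pi"
proof -
  have "incseq (\<lambda>n. real n * central_prob n)"
  proof (rule incseq_SucI)
    fix n
    have "real n * central_prob n \<le> central_prob n * ((2 * real n + 1)\<^sup>2 / (4 * (real n + 1)))"
      using central_prob_pos[of n]
      by (subst mult.commute, intro mult_left_mono) (auto simp: divide_simps power2_eq_square algebra_simps)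
    also have "\<dots> = real (Suc n) * central_prob (Suc n)"
      by (simp add: central_prob_Suc divide_simps) (simp add: power2_eq_square algebra_simps)
    finally show "real n * central_prob n \<le> real (Suc n) * central_prob (Suc n)" .
  qed
  moreover have "(\<lambda>n. real n * central_prob n) \<longlonglongrightarrow> 1 / pi"
  proof -
    have "(\<lambda>n. (2 * real n + 1) * central_prob n * (real n / (2 * real n + 1))) \<longlonglongrightarrow> 2 / pi * (1 / 2)"
      by (intro tendsto_mult tendsto_central_prob) real_asymp
    moreover have "(2 * real n + 1) * central_prob n * (real n / (2 * real n + 1)) = real n * central_prob n" for n
      by (simp add: divide_simps mult.commute)
    ultimately show ?thesis
      by (simp only:) simp
  qed
  ultimately show ?thesis
    by (rule incseq_le)
qed

lemma sum_central_prob_ge: "(\<Sum>i\<le>n. central_prob i) \<ge> ln (real n + 1) / pi"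
proof -
  have "ln (real n + 1) / pi \<le> harm n / pi"
    by (intro divide_right_mono harm_ge_ln) auto
  also have "\<dots> = (\<Sum>i<n. 1 / (pi * (real i + 1)))"
    by (simp add: harm_altdef sum_divide_distrib field_simps)
  also have "\<dots> \<le> (\<Sum>i\<le>n. central_prob i)"
    by (intro sum_mono2 order_trans[OF sum_mono[OF central_prob_ge] sum_mono2])
       (auto intro: less_imp_le central_prob_pos)
  finally show ?thesis .
qed

text \<open>The term at 0 is split off, because \<open>central_prob_le\<close> gives no bound there.
  The rest is at most \<open>harm n / pi\<close>, and \<open>harm n - ln n\<close> decreases from
  its value 1 at \<open>n = 1\<close>.\<close>

lemma sum_central_prob_le:
  assumes "n \<ge> 1"
  shows "(\<Sum>i\<le>n. central_prob i) \<le> 1 + (1 + ln (real n)) / pi"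
proof -
  have "(\<Sum>i\<le>n. central_prob i) = 1 + (\<Sum>i=1..n. central_prob i)"
    by (simp add: atMost_atLeast0 sum.atLeast_Suc_atMost)
  also have "(\<Sum>i=1..n. central_prob i) \<le> (\<Sum>i=1..n. inverse (real i) / pi)"
    using central_prob_le by (intro sum_mono) (simp add: field_simps)
  also have "\<dots> = harm n / pi"
    by (simp add: harm_def sum_divide_distrib)
  also have "harm n \<le> 1 + ln (real n)"
    using euler_mascheroni_sequence_decreasing[of 1 n] assms by (simp add: harm_expand)
  finally show ?thesis by (simp add: divide_right_mono)
qed

section \<open>Asymptotics of the coefficients of powers of the generating function\<close>

definition central_fps :: "real fps" where
  "central_fps = Abs_fps central_prob"

lemma central_fps_nth_nonneg: "fps_nth central_fps i \<ge> 0"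
  by (simp add: central_fps_def central_prob_pos less_imp_le)

text \<open>In \<open>fps_nth_power_deriv\<close> each weight i b_i is at most 1/pi. What remains is
  a partial sum of coefficients of the \<open>k\<close>-th power.\<close>

lemma central_fps_power_le:
  assumes "n \<ge> 1"
  shows "real n * fps_nth (central_fps ^ Suc k) n \<le> real (Suc k) / pi * (1 + (1 + ln (real n)) / pi) ^ k"
proof -
  have "(\<Sum>i\<le>n. real i * fps_nth central_fps i * fps_nth (central_fps ^ k) (n - i)) \<le>
      (\<Sum>i\<le>n. 1 / pi * fps_nth (central_fps ^ k) (n - i))"
    by (intro sum_mono mult_right_mono fps_nth_power_nonneg central_fps_nth_nonneg)
       (simp add: central_fps_def central_prob_le)
  also have "\<dots> = 1 / pi * (\<Sum>i\<le>n. fps_nth (central_fps ^ k) i)"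
    unfolding sum_distrib_left
    by (intro sum.reindex_bij_witness[of _ "\<lambda>i. n - i" "\<lambda>i. n - i"]) auto
  also have "\<dots> \<le> 1 / pi * (\<Sum>i\<le>n. fps_nth central_fps i) ^ k"
    by (intro mult_left_mono sum_fps_nth_power_le central_fps_nth_nonneg) auto
  also have "\<dots> \<le> 1 / pi * (1 + (1 + ln (real n)) / pi) ^ k"
    using sum_central_prob_le[OF assms]
    by (intro mult_left_mono power_mono sum_nonneg central_fps_nth_nonneg) (auto simp: central_fps_def)
  finally have "real (Suc k) * (\<Sum>i\<le>n. real i * fps_nth central_fps i * fps_nth (central_fps ^ k) (n - i)) \<le>
      real (Suc k) * (1 / pi * (1 + (1 + ln (real n)) / pi) ^ k)"
    by (intro mult_left_mono) auto
  then show ?thesis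
    unfolding fps_nth_power_deriv[of n central_fps "Suc k"] by simp
qed

text \<open>Only the indices \<open>i \<ge> m\<close> are kept, where i b_i is nearly 1/pi. The
  complementary indices \<open>n - i\<close> then run up to \<open>n - m \<ge> k * m\<close>, as
  \<open>sum_fps_nth_power_ge\<close> requires.\<close>

lemma central_fps_power_ge:
  fixes m :: nat
  assumes "Suc k * m \<le> n"
  shows "real n * fps_nth (central_fps ^ Suc k) n \<ge>
    real (Suc k) / pi * (real m / (real m + 1)) * (ln (real m + 1) / pi) ^ k"
proof -
  have "real m / (pi * (real m + 1)) * (ln (real m + 1) / pi) ^ k
      \<le> real m / (pi * (real m + 1)) * (\<Sum>i\<le>m. fps_nth central_fps i) ^ k"
    using sum_central_prob_ge[of m] by (intro mult_left_mono power_mono) (auto simp: central_fps_def)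
  also have "\<dots> \<le> real m / (pi * (real m + 1)) * (\<Sum>i\<le>n - m. fps_nth (central_fps ^ k) i)"
    using assms by (intro mult_left_mono sum_fps_nth_power_ge central_fps_nth_nonneg) auto
  also have "\<dots> = (\<Sum>i\<in>{m..n}. real m / (pi * (real m + 1)) * fps_nth (central_fps ^ k) (n - i))"
    unfolding sum_distrib_left using assms
    by (intro sum.reindex_bij_witness[of _ "\<lambda>i. n - i" "\<lambda>i. n - i"]) auto
  also have "\<dots> \<le> (\<Sum>i\<in>{m..n}. real i * fps_nth central_fps i * fps_nth (central_fps ^ k) (n - i))"
  proof (intro sum_mono mult_right_mono fps_nth_power_nonneg central_fps_nth_nonneg)
    fix i assume i: "i \<in> {m..n}"
    \<comment> \<open>As x / (x + 1) is increasing, the bound at \<open>m\<close> serves uniformly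
      for all \<open>i \<ge> m\<close>.\<close>
    have "real m / (pi * (real m + 1)) \<le> real i * (1 / (pi * (real i + 1)))"
    proof -
      have "real m / (real m + 1) \<le> real i / (real i + 1)"
        using i by (simp add: divide_simps) (simp add: algebra_simps)
      then have "real m / (real m + 1) / pi \<le> real i / (real i + 1) / pi"
        by (rule divide_right_mono) simp
      then show ?thesis
        by (simp only: divide_divide_eq_left mult.commute[of pi] times_divide_eq_right mult_1_right)
    qed
    also have "\<dots> \<le> real i * fps_nth central_fps i"
      using central_prob_ge[of i] by (intro mult_left_mono) (auto simp: central_fps_def)
    finally show "real m / (pi * (real m + 1)) \<le> real i * fps_nth central_fps i" .
  qed
  also have "\<dots> \<le> (\<Sum>i\<le>n. real i * fps_nth central_fps i * fps_nth (central_fps ^ k) (n - i))"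
    by (intro sum_mono2) (auto intro!: mult_nonneg_nonneg fps_nth_power_nonneg central_fps_nth_nonneg)
  finally have "real (Suc k) * (real m / (pi * (real m + 1)) * (ln (real m + 1) / pi) ^ k) \<le>
      real n * fps_nth (central_fps ^ Suc k) n"
    unfolding fps_nth_power_deriv[of n central_fps "Suc k"] by (intro mult_left_mono) auto
  then show ?thesis by (simp add: field_simps)
qed

text \<open>The two bounds are squeezed together, the lower one with the largest admissible
  \<open>m = n div Suc k\<close>. This \<open>m\<close> is of order \<open>n\<close>, so passing
  from \<open>n\<close> to \<open>m\<close> does not affect the logarithm to leading order.\<close>

lemma tendsto_central_fps_power:
  "(\<lambda>n. real n * fps_nth (central_fps ^ Suc k) n * (pi / ln (real n)) ^ k)
     \<longlonglongrightarrow> real (Suc k) / pi"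
proof (rule tendsto_sandwich)
  show "\<forall>\<^sub>F n in sequentially. real n * fps_nth (central_fps ^ Suc k) n * (pi / ln (real n)) ^ k \<le>
      real (Suc k) / pi * ((1 + (1 + ln (real n)) / pi) * (pi / ln (real n))) ^ k"
    using eventually_ge_at_top[of 1]
  proof eventually_elim
    case (elim n)
    then show ?case
      using mult_right_mono[OF central_fps_power_le[of n k], of "(pi / ln (real n)) ^ k"]
      by (simp only: power_mult_distrib mult.assoc) simp
  qed
  show "\<forall>\<^sub>F n in sequentially. real (Suc k) / pi * (real (n div Suc k) / (real (n div Suc k) + 1)) *
        (ln (real (n div Suc k) + 1) / pi * (pi / ln (real n))) ^ k
      \<le> real n * fps_nth (central_fps ^ Suc k) n * (pi / ln (real n)) ^ k"
    using eventually_ge_at_top[of 1]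
  proof eventually_elim
    case (elim n)
    have "Suc k * (n div Suc k) \<le> n" by (rule times_div_less_eq_dividend)
    then show ?case
      using mult_right_mono[OF central_fps_power_ge[of k "n div Suc k" n], of "(pi / ln (real n)) ^ k"] elim
      by (simp only: power_mult_distrib mult.assoc) simp
  qed
  have "(\<lambda>n. (1 + (1 + ln (real n)) / pi) * (pi / ln (real n))) \<longlonglongrightarrow> 1"
    by real_asymp
  from tendsto_mult[OF tendsto_const[of "real (Suc k) / pi"] tendsto_power[OF this, of k]]
  show "(\<lambda>n. real (Suc k) / pi * ((1 + (1 + ln (real n)) / pi) * (pi / ln (real n))) ^ k)
      \<longlonglongrightarrow> real (Suc k) / pi"
    by (simp only: power_one mult_1_right)
  have m: "filterlim (\<lambda>n. n div Suc k) at_top sequentially"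
    unfolding filterlim_at_top
  proof
    fix Z
    show "\<forall>\<^sub>F n in sequentially. Z \<le> n div Suc k"
      using eventually_ge_at_top[of "Z * Suc k"]
      by eventually_elim (simp add: less_eq_div_iff_mult_less_eq del: mult_Suc_right)
  qed
  have "(\<lambda>m. real m / (real m + 1)) \<longlonglongrightarrow> 1"
    by real_asymp
  from filterlim_compose[OF this m]
  have 1: "(\<lambda>n. real (n div Suc k) / (real (n div Suc k) + 1)) \<longlonglongrightarrow> 1" .
  \<comment> \<open>With \<open>c = Suc k\<close> we have
    \<open>n / c \<le> n div Suc k + 1 \<le> n + 1\<close>, so this logarithm differs from
    \<open>ln n\<close> by a bounded amount.\<close>
  have 2: "(\<lambda>n. ln (real (n div Suc k) + 1) / ln (real n)) \<longlonglongrightarrow> 1"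
  proof (rule tendsto_sandwich)
    define c where "c = real (Suc k)"
    have "c > 0" by (simp add: c_def)
    then show "(\<lambda>n. ln (real n / c) / ln (real n)) \<longlonglongrightarrow> 1"
      by real_asymp
    show "(\<lambda>n. ln (real n + 1) / ln (real n)) \<longlonglongrightarrow> 1"
      by real_asymp
    show "\<forall>\<^sub>F n in sequentially. ln (real n / c) / ln (real n) \<le> ln (real (n div Suc k) + 1) / ln (real n)"
      using eventually_ge_at_top[of 1]
    proof eventually_elim
      case (elim n)
      have "n < (n div Suc k + 1) * Suc k"
        using dividend_less_times_div[of "Suc k" n] by (simp add: algebra_simps)
      then have "real n < real ((n div Suc k + 1) * Suc k)"
        by (simp only: of_nat_less_iff)
      also have "\<dots> = (real (n div Suc k) + 1) * c"
        by (simp add: c_def algebra_simps)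
      finally have "real n / c \<le> real (n div Suc k) + 1"
        using \<open>c > 0\<close> by (simp add: field_simps)
      then show ?case
        using elim \<open>c > 0\<close> by (intro divide_right_mono) auto
    qed
    show "\<forall>\<^sub>F n in sequentially. ln (real (n div Suc k) + 1) / ln (real n) \<le> ln (real n + 1) / ln (real n)"
      using eventually_ge_at_top[of 1]
      by eventually_elim (auto intro!: divide_right_mono)
  qed
  show "(\<lambda>n. real (Suc k) / pi * (real (n div Suc k) / (real (n div Suc k) + 1)) *
        (ln (real (n div Suc k) + 1) / pi * (pi / ln (real n))) ^ k) \<longlonglongrightarrow> real (Suc k) / pi"
    using tendsto_mult[OF tendsto_mult[OF tendsto_const[of "real (Suc k) / pi"] 1] tendsto_power[OF 2, of k]]
    by (simp only: times_divide_times_eq mult_divide_mult_cancel_right[OF pi_neq_zero] mult.commute[of pi] power_one mult_1_right)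
qed

section \<open>Ranks in finite sets and sums of rising factorials\<close>

lemma sum_card_atMost_Int:
  fixes Z :: "'a::linorder set"
  assumes "finite Z"
  shows "(\<Sum>z\<in>Z. f (card (Z \<inter> {..z}))) = (\<Sum>j=1..card Z. f j)"
  using assms
\<comment> \<open>Adding a new maximum leaves the ranks below it unchanged and contributes the next
  rank, so each rank occurs exactly once.\<close>
proof (induction Z rule: finite_linorder_max_induct)
  case (insert b Z)
  have b: "b \<notin> Z" using insert by auto
  have "insert b Z \<inter> {..b} = insert b Z"
    using insert by auto
  moreover have "insert b Z \<inter> {..z} = Z \<inter> {..z}" if "z \<in> Z" for z
    using insert that by auto
  ultimately show ?case
    using b insert by (simp add: add.commute)
qed simp

text \<open>The sum telescopes: the increment of \<open>pochhammer m (Suc k)\<close> from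
  \<open>m\<close> to \<open>m + 1\<close> is \<open>(k + 1) * pochhammer (m + 1) k\<close>.\<close>

lemma sum_pochhammer:
  "of_nat (Suc k) * (\<Sum>j=1..m. pochhammer (of_nat j) k) = (pochhammer (of_nat m) (Suc k) :: 'a::comm_ring_1)"
proof (induction m)
  case (Suc m)
  have "pochhammer (of_nat (Suc m)) (Suc k) = (pochhammer (of_nat (Suc m)) k * (of_nat (Suc m) + of_nat k) :: 'a)"
    by (rule pochhammer_Suc)
  moreover have "pochhammer (of_nat m) (Suc k) = (of_nat m * pochhammer (of_nat (Suc m)) k :: 'a)"
    by (simp add: pochhammer_rec add.commute)
  ultimately show ?case
    using Suc by (simp add: algebra_simps)
qed (simp add: pochhammer_rec)

section \<open>Counting bridges and cutting them at a zero\<close>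

lemma card_Int_lessThan_Suc:
  "card (S \<inter> {..<Suc i}) = card (S \<inter> {..<i}) + (if i \<in> S then 1 else 0)"
proof (cases "i \<in> S")
  case True
  then have "S \<inter> {..<Suc i} = insert i (S \<inter> {..<i})" by auto
  with True show ?thesis by simp
next
  case False
  then have "S \<inter> {..<Suc i} = S \<inter> {..<i}" by (auto simp: less_Suc_eq)
  with False show ?thesis by simp
qed

text \<open>The position is the number of up-steps minus the number of down-steps so far, and these
  two numbers add up to \<open>i\<close>.\<close>

lemma bridge_nth_eq:
  assumes "x \<in> srw_bridges n" "i \<le> 2 * n"
  shows "x ! i = 2 * int (card ({j\<in>{..<2 * n}. x ! Suc j - x ! j = 1} \<inter> {..<i})) - int i"
  using assms(2)
proof (induction i)
  case 0
  then show ?case using assms by (simp add: srw_bridges_def)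
next
  case (Suc i)
  have "x ! Suc i - x ! i \<in> {-1, 1}"
    using assms(1) Suc.prems by (simp add: srw_bridges_def)
  with Suc show ?case
    by (auto simp: card_Int_lessThan_Suc)
qed

text \<open>A bridge is determined by its set of up-steps, which can be any \<open>n\<close>-subset
  of the \<open>2 * n\<close> steps.\<close>

lemma card_srw_bridges: "card (srw_bridges n) = (2 * n) choose n"
proof -
  let ?up = "\<lambda>x :: int list. {j\<in>{..<2 * n}. x ! Suc j - x ! j = 1}"
  let ?path = "\<lambda>S. map (\<lambda>i. 2 * int (card (S \<inter> {..<i})) - int i) [0..<2 * n + 1]"
  have nth_path: "?path S ! i = 2 * int (card (S \<inter> {..<i})) - int i" if "i \<le> 2 * n" for S i
    using that by (simp del: upt_Suc)
  have "bij_betw ?up (srw_bridges n) {S. S \<subseteq> {..<2 * n} \<and> card S = n}"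
  proof (rule bij_betw_byWitness[where f' = ?path])
    show "\<forall>x\<in>srw_bridges n. ?path (?up x) = x"
    proof
      fix x assume x: "x \<in> srw_bridges n"
      then have "length x = 2 * n + 1" by (simp add: srw_bridges_def)
      then show "?path (?up x) = x"
        by (intro nth_equalityI) (auto simp: nth_path bridge_nth_eq[OF x] simp del: upt_Suc)
    qed
    have step: "?path S ! Suc j - ?path S ! j = (if j \<in> S then 1 else -1)" if "j < 2 * n" for S j
      using that by (simp only: nth_path[of j] nth_path[of "Suc j"] less_imp_le Suc_leI)
        (simp add: card_Int_lessThan_Suc)
    show "\<forall>S\<in>{S. S \<subseteq> {..<2 * n} \<and> card S = n}. ?up (?path S) = S"
    proof
      fix S assume "S \<in> {S. S \<subseteq> {..<2 * n} \<and> card S = n}"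
      then have "S \<subseteq> {..<2 * n}" by simp
      moreover have "j \<in> ?up (?path S) \<longleftrightarrow> j \<in> {..<2 * n} \<and> j \<in> S" for j
        using step[of j S] by (simp only: mem_Collect_eq lessThan_iff) (auto split: if_splits)
      ultimately show "?up (?path S) = S" by blast
    qed
    show "?up ` srw_bridges n \<subseteq> {S. S \<subseteq> {..<2 * n} \<and> card S = n}"
    proof safe
      fix x assume x: "x \<in> srw_bridges n"
      have "?up x \<inter> {..<2 * n} = ?up x" by auto
      then show "card (?up x) = n"
        using bridge_nth_eq[OF x, of "2 * n"] x by (simp add: srw_bridges_def)
    qed
    show "?path ` {S. S \<subseteq> {..<2 * n} \<and> card S = n} \<subseteq> srw_bridges n"
    proof (rule image_subsetI)
      fix S assume "S \<in> {S. S \<subseteq> {..<2 * n} \<and> card S = n}"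
      then have S: "S \<subseteq> {..<2 * n}" "card S = n" by auto
      have "S \<inter> {..<2 * n} = S" using S by auto
      then have "?path S ! (2 * n) = 0" "?path S ! 0 = 0"
        using S(2) by (simp_all only: nth_path order_refl le0) simp_all
      then show "?path S \<in> srw_bridges n"
        unfolding srw_bridges_def using step[of _ S] by (simp del: upt_Suc)
    qed
  qed
  then show ?thesis
    by (simp add: bij_betw_same_card n_subsets)
qed

text \<open>The vertex at time \<open>2 * m\<close> belongs to both pieces, whence the overlap of
  \<open>take\<close> and \<open>drop\<close>. Gluing removes the duplicate by
  \<open>tl\<close>.\<close>

lemma bridge_split:
  assumes "m \<le> n"
  shows "bij_betw (\<lambda>x. (take (2 * m + 1) x, drop (2 * m) x)) {x \<in> srw_bridges n. x ! (2 * m) = 0}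
    (srw_bridges m \<times> srw_bridges (n - m))"
proof (rule bij_betw_byWitness[where f' = "\<lambda>(y, z). y @ tl z"])
  have nn: "2 * m + 2 * (n - m) = 2 * n" using assms by simp
  show "\<forall>x\<in>{x \<in> srw_bridges n. x ! (2 * m) = 0}.
      (case (take (2 * m + 1) x, drop (2 * m) x) of (y, z) \<Rightarrow> y @ tl z) = x"
    by (auto simp: tl_drop simp flip: drop_Suc)
  show "\<forall>p\<in>srw_bridges m \<times> srw_bridges (n - m).
      (take (2 * m + 1) (case p of (y, z) \<Rightarrow> y @ tl z), drop (2 * m) (case p of (y, z) \<Rightarrow> y @ tl z)) = p"
  proof safe
    fix y z assume y: "y \<in> srw_bridges m" and z: "z \<in> srw_bridges (n - m)"
    from y have ly: "length y = 2 * m + 1" and y0: "y ! (2 * m) = 0" by (auto simp: srw_bridges_def)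
    from z have lz: "z \<noteq> []" and z0: "z ! 0 = 0" by (auto simp: srw_bridges_def)
    have "drop (2 * m) y = [0]"
      using Cons_nth_drop_Suc[of "2 * m" y] ly y0 by simp
    then show "drop (2 * m) (y @ tl z) = z"
      using ly lz z0 by (cases z) auto
    show "take (2 * m + 1) (y @ tl z) = y" using ly by simp
  qed
  show "(\<lambda>x. (take (2 * m + 1) x, drop (2 * m) x)) ` {x \<in> srw_bridges n. x ! (2 * m) = 0}
      \<subseteq> srw_bridges m \<times> srw_bridges (n - m)"
  proof (rule image_subsetI)
    fix x assume x: "x \<in> {x \<in> srw_bridges n. x ! (2 * m) = 0}"
    then have "x ! Suc i - x ! i \<in> {-1, 1}" if "i < 2 * n" for i
      using that by (simp add: srw_bridges_def)
    \<comment> \<open>The step condition is used twice: for indices below \<open>2 * m\<close> in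
      the first piece, and shifted by \<open>2 * m\<close> in the second.\<close>
    from this[OF less_le_trans, of _ "2 * m"] this[of "2 * m + _"]
    show "(take (2 * m + 1) x, drop (2 * m) x) \<in> srw_bridges m \<times> srw_bridges (n - m)"
      using x assms nn by (simp add: srw_bridges_def)
  qed
  show "(\<lambda>(y, z). y @ tl z) ` (srw_bridges m \<times> srw_bridges (n - m)) \<subseteq> {x \<in> srw_bridges n. x ! (2 * m) = 0}"
  proof safe
    fix y z assume y: "y \<in> srw_bridges m" and z: "z \<in> srw_bridges (n - m)"
    from y have ly: "length y = 2 * m + 1" and y0: "y ! (2 * m) = 0" by (auto simp: srw_bridges_def)
    from z have lz: "length z = 2 * (n - m) + 1" and z0: "z ! 0 = 0" by (auto simp: srw_bridges_def)
    have left: "(y @ tl z) ! i = y ! i" if "i \<le> 2 * m" for i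
      using that ly by (simp add: nth_append)
    have right: "(y @ tl z) ! (2 * m + i) = z ! i" if "i \<le> 2 * (n - m)" for i
      using that ly lz y0 z0 by (cases i) (auto simp: nth_append nth_tl)
    show "(y @ tl z) ! (2 * m) = 0" using left y0 by simp
    have "(y @ tl z) ! Suc i - (y @ tl z) ! i \<in> {-1, 1}" if "i < 2 * n" for i
    proof (cases "i < 2 * m")
      case True
      then show ?thesis using y by (simp add: left srw_bridges_def)
    next
      case False
      then obtain j where j: "i = 2 * m + j" by (metis add_diff_inverse_nat)
      then have "j < 2 * (n - m)" using that by simp
      then show ?thesis using z right[of j] right[of "Suc j"] by (simp add: j srw_bridges_def)
    qed
    moreover have "(y @ tl z) ! 0 = 0"
      using left[of 0] y by (simp add: srw_bridges_def)
    moreover have "(y @ tl z) ! (2 * n) = 0"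
      using right[of "2 * (n - m)"] z nn by (simp add: srw_bridges_def)
    ultimately show "y @ tl z \<in> srw_bridges n"
      using ly lz assms by (simp add: srw_bridges_def)
  qed
qed

section \<open>Common zeros of pairs of bridges and their rising factorial sums\<close>

abbreviation bridge_pairs :: "nat \<Rightarrow> (int list \<times> int list) set" where
  "bridge_pairs n \<equiv> srw_bridges n \<times> srw_bridges n"

lemma card_bridge_pairs: "real (card (bridge_pairs n)) = (real ((2 * n) choose n))\<^sup>2"
  by (simp add: card_cartesian_product card_srw_bridges power2_eq_square)

lemma common_zeros_altdef:
  assumes "p \<in> bridge_pairs n"
  shows "common_zeros n p = {t. t \<le> n \<and> fst p ! (2 * t) = 0 \<and> snd p ! (2 * t) = 0}"
  using assms by (auto simp: common_zeros_def srw_bridges_def not_less_eq_eq)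

lemma finite_common_zeros: "finite (common_zeros n p)"
  by (simp add: common_zeros_def)

text \<open>After cutting both walks at the common zero \<open>m\<close>, the common zeros up to
  \<open>m\<close> depend only on the first pieces. The second pieces are free and contribute just
  their number.\<close>

lemma sum_bridge_pairs_split:
  fixes f :: "nat set \<Rightarrow> real"
  assumes "m \<le> n"
  shows "(\<Sum>p | p \<in> bridge_pairs n \<and> m \<in> common_zeros n p. f (common_zeros n p \<inter> {..m})) =
    (\<Sum>p\<in>bridge_pairs m. f (common_zeros m p)) * real (card (bridge_pairs (n - m)))"
proof -
  let ?B = "{x \<in> srw_bridges n. x ! (2 * m) = 0}"
  let ?Z = "\<lambda>(x :: int list, y :: int list). {t. t \<le> m \<and> x ! (2 * t) = 0 \<and> y ! (2 * t) = 0}"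
  let ?s = "\<lambda>x :: int list. (take (2 * m + 1) x, drop (2 * m) x)"
  have "{p. p \<in> bridge_pairs n \<and> m \<in> common_zeros n p} = ?B \<times> ?B"
    using assms by (auto simp: common_zeros_altdef)
  then have "(\<Sum>p | p \<in> bridge_pairs n \<and> m \<in> common_zeros n p. f (common_zeros n p \<inter> {..m})) =
      (\<Sum>p\<in>?B \<times> ?B. f (common_zeros n p \<inter> {..m}))"
    by simp
  also have "\<dots> = (\<Sum>x\<in>?B. \<Sum>y\<in>?B. f (?Z (fst (?s x), fst (?s y))))"
    unfolding sum.cartesian_product using assms
    by (intro sum.cong refl) (auto simp: common_zeros_altdef intro!: arg_cong[of _ _ f])
  \<comment> \<open>The splitting bijection is applied to each of the two walks in turn.\<close>
  also have "\<dots> = (\<Sum>x'\<in>srw_bridges m \<times> srw_bridges (n - m). \<Sum>y'\<in>srw_bridges m \<times> srw_bridges (n - m).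
      f (?Z (fst x', fst y')))"
    by (subst sum.reindex_bij_betw[OF bridge_split[OF assms],
          where g = "\<lambda>x'. \<Sum>y\<in>?B. f (?Z (fst x', fst (?s y)))"])
       (intro sum.cong refl sum.reindex_bij_betw[OF bridge_split[OF assms]])
  also have "\<dots> = (\<Sum>x\<in>srw_bridges m. \<Sum>y\<in>srw_bridges m. f (?Z (x, y))) * real (card (bridge_pairs (n - m)))"
    by (simp only: sum.cartesian_product' fst_conv sum_constant)
       (simp add: card_cartesian_product sum_distrib_right sum_distrib_left mult_ac)
  also have "(\<Sum>x\<in>srw_bridges m. \<Sum>y\<in>srw_bridges m. f (?Z (x, y))) = (\<Sum>p\<in>bridge_pairs m. f (common_zeros m p))"
    unfolding sum.cartesian_product
    by (intro sum.cong refl) (auto simp: common_zeros_altdef intro!: arg_cong[of _ _ f])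
  finally show ?thesis .
qed

text \<open>Induction on \<open>k\<close> peels off the last cut \<open>m\<close>. The pairs up to
  \<open>m\<close> are covered by the induction hypothesis, and the free remainder adds one more
  factor to the convolution.\<close>

lemma sum_pochhammer_common_zeros:
  "(\<Sum>p\<in>bridge_pairs n. pochhammer (real (card (common_zeros n p))) k) =
     fact k * fps_nth (Abs_fps (\<lambda>i. real (card (bridge_pairs i))) ^ Suc k) n"
proof (induction k arbitrary: n)
  case 0
  then show ?case by simp
next
  case (Suc k)
  let ?A = "Abs_fps (\<lambda>i. real (card (bridge_pairs i)))"
  let ?f = "\<lambda>S :: nat set. pochhammer (real (card S)) k"
  have fin: "finite (bridge_pairs i)" for i
    by (simp add: finite_srw_bridges)
  \<comment> \<open>The ranks of the common zeros run through \<open>1..card\<close>, so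
    \<open>sum_pochhammer\<close> writes the rising factorial as a sum over the zeros.\<close>
  have "(\<Sum>p\<in>bridge_pairs n. pochhammer (real (card (common_zeros n p))) (Suc k)) =
      real (Suc k) * (\<Sum>p\<in>bridge_pairs n. \<Sum>m\<in>common_zeros n p. ?f (common_zeros n p \<inter> {..m}))"
    unfolding sum_card_atMost_Int[OF finite_common_zeros, where f = "\<lambda>j. pochhammer (real j) k"]
    by (simp only: sum_pochhammer[symmetric] sum_distrib_left)
  also have "(\<Sum>p\<in>bridge_pairs n. \<Sum>m\<in>common_zeros n p. ?f (common_zeros n p \<inter> {..m})) =
      (\<Sum>p\<in>bridge_pairs n. \<Sum>m | m \<in> {..n} \<and> m \<in> common_zeros n p. ?f (common_zeros n p \<inter> {..m}))"
    by (intro sum.cong refl) (auto simp: common_zeros_def)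
  also have "\<dots> = (\<Sum>m\<le>n. \<Sum>p | p \<in> bridge_pairs n \<and> m \<in> common_zeros n p. ?f (common_zeros n p \<inter> {..m}))"
    by (rule sum.swap_restrict) (use fin in auto)
  also have "\<dots> = (\<Sum>m\<le>n. fact k * fps_nth (?A ^ Suc k) m * fps_nth ?A (n - m))"
    by (intro sum.cong refl) (simp only: sum_bridge_pairs_split[where f = ?f] Suc.IH atMost_iff fps_nth_Abs_fps)
  also have "\<dots> = fact k * fps_nth (?A ^ Suc k * ?A) n"
    by (simp only: fps_mult_nth atLeast0AtMost sum_distrib_left mult.assoc)
  finally show ?case
    by (simp add: mult_ac)
qed

section \<open>Limits of the rising factorial moments\<close>

lemma expectation_two_srw_bridges:
  fixes f :: "int list \<times> int list \<Rightarrow> real"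
  shows "measure_pmf.expectation (two_srw_bridges n) f =
    (\<Sum>p\<in>bridge_pairs n. f p) / real (card (bridge_pairs n))"
proof -
  \<comment> \<open>Two independent uniform bridges form a uniform element of the product
    set.\<close>
  have "two_srw_bridges n = pmf_of_set (bridge_pairs n)"
    unfolding two_srw_bridges_def
    by (intro pmf_eqI) (auto simp: pmf_pair finite_srw_bridges srw_bridges_nonempty
        card_cartesian_product indicator_def)
  then show ?thesis
    by (simp add: integral_pmf_of_set finite_srw_bridges srw_bridges_nonempty)
qed

lemma bridge_fps_power_eq:
  "fps_nth (Abs_fps (\<lambda>i. (real ((2 * i) choose i))\<^sup>2) ^ k) n = 16 ^ n * fps_nth (central_fps ^ k) n"
  using fps_nth_power_scaled[of 16 central_prob k n]
  by (simp add: central_fps_def central_prob_def)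

text \<open>The moment is a ratio of coefficients of powers \<open>Suc k\<close> and
  \<open>1\<close> of \<open>central_fps\<close>, the factors \<open>16 ^ n\<close> cancelling.
  \<open>tendsto_central_fps_power\<close> handles both; the limit is
  \<open>fact k * (k + 1)\<close>.\<close>

lemma tendsto_expectation_pochhammer:
  "(\<lambda>n. measure_pmf.expectation (two_srw_bridges n)
       (\<lambda>x. pochhammer (real (card (common_zeros n x))) k) * (pi / ln (real n)) ^ k) \<longlonglongrightarrow> fact (k + 1)"
proof -
  have "(\<lambda>n. fact k * (real n * fps_nth (central_fps ^ Suc k) n * (pi / ln (real n)) ^ k) /
      (real n * fps_nth (central_fps ^ Suc 0) n * (pi / ln (real n)) ^ 0))
      \<longlonglongrightarrow> fact k * (real (Suc k) / pi) / (real (Suc 0) / pi)"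
    by (intro tendsto_intros tendsto_central_fps_power) auto
  also have "fact k * (real (Suc k) / pi) / (real (Suc 0) / pi) = fact (k + 1)"
    by simp
  finally have lim: "(\<lambda>n. fact k * (real n * fps_nth (central_fps ^ Suc k) n * (pi / ln (real n)) ^ k) /
      (real n * fps_nth (central_fps ^ Suc 0) n * (pi / ln (real n)) ^ 0)) \<longlonglongrightarrow> fact (k + 1)" .
  have "\<forall>\<^sub>F n in sequentially.
      fact k * (real n * fps_nth (central_fps ^ Suc k) n * (pi / ln (real n)) ^ k) /
      (real n * fps_nth (central_fps ^ Suc 0) n * (pi / ln (real n)) ^ 0) =
      measure_pmf.expectation (two_srw_bridges n)
       (\<lambda>x. pochhammer (real (card (common_zeros n x))) k) * (pi / ln (real n)) ^ k"
    using eventually_gt_at_top[of 0]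
  proof eventually_elim
    case (elim n)
    have "real (card (bridge_pairs n)) = 16 ^ n * fps_nth central_fps n"
      by (simp add: card_bridge_pairs central_fps_def central_prob_def)
    then show ?case
      unfolding expectation_two_srw_bridges sum_pochhammer_common_zeros
      using elim by (simp add: card_bridge_pairs bridge_fps_power_eq del: power_Suc)
  qed
  with lim show ?thesis
    by (rule Lim_transform_eventually)
qed

section \<open>Convolution asymptotics and the passage to ordinary moments\<close>

theorem theorem5:
  fixes a :: "nat \<Rightarrow> real"
  assumes a_def: "\<And>n. a n = (real ((2 * n) choose n))\<^sup>2"
  shows "(\<forall>k\<ge>1. (\<lambda>n. conv_power k a n) \<sim>[sequentially]
            (\<lambda>n. exp (4 * real n * ln 2) / (real n * pi) * (ln (real n) / pi) ^ (k - 1) * real k)) \<and>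
         (\<forall>k\<ge>1. (\<lambda>n. measure_pmf.expectation (two_srw_bridges n)
                     (\<lambda>x. (pi / ln (real n) * real (card (common_zeros n x))) ^ k))
            \<longlonglongrightarrow> fact (k + 1))"
proof (intro conjI allI impI)
  fix k :: nat assume "k \<ge> 1"
  then obtain l where k: "k = Suc l"
    by (cases k) auto
  have a: "a = (\<lambda>n. (real ((2 * n) choose n))\<^sup>2)"
    using a_def by auto
  have exp: "exp (4 * real n * ln 2) = 16 ^ n" for n
    using exp_of_nat_mult[of n "4 * ln (2 :: real)"] exp_of_nat_mult[of 4 "ln (2 :: real)"]
    by (simp add: mult_ac)
  show "(\<lambda>n. conv_power k a n) \<sim>[sequentially]
      (\<lambda>n. exp (4 * real n * ln 2) / (real n * pi) * (ln (real n) / pi) ^ (k - 1) * real k)"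
  proof (rule asymp_equivI')
    \<comment> \<open>This also holds at \<open>n = 0\<close>, where both sides are 0 because
      division by zero yields 0.\<close>
    have eq: "16 ^ n * X / (16 ^ n / (real n * pi) * (ln (real n) / pi) ^ l * real k) =
        real n * X * (pi / ln (real n)) ^ l / (real k / pi)" for n X
      by (simp add: power_divide)
    have "(\<lambda>n. real n * fps_nth (central_fps ^ Suc l) n * (pi / ln (real n)) ^ l / (real k / pi)) \<longlonglongrightarrow> real (Suc l) / pi / (real k / pi)"
      by (intro tendsto_divide tendsto_const tendsto_central_fps_power) (simp add: k)
    then have "(\<lambda>n. real n * fps_nth (central_fps ^ Suc l) n * (pi / ln (real n)) ^ l / (real k / pi)) \<longlonglongrightarrow> 1"
      by (simp add: k)
    then show "(\<lambda>n. conv_power k a n / (exp (4 * real n * ln 2) / (real n * pi) * (ln (real n) / pi) ^ (k - 1) * real k)) \<longlonglongrightarrow> 1"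
      unfolding exp conv_power_eq_fps_nth a bridge_fps_power_eq eq[symmetric] by (simp only: k diff_Suc_1)
  qed
next
  fix k :: nat
  let ?L = "\<lambda>n x. real (card (common_zeros n x))"
  let ?E = "\<lambda>n f. measure_pmf.expectation (two_srw_bridges n) (f :: _ \<Rightarrow> real)"
  show "(\<lambda>n. ?E n (\<lambda>x. (pi / ln (real n) * ?L n x) ^ k)) \<longlonglongrightarrow> fact (k + 1)"
  proof (induction k rule: less_induct)
    case (less k)
    have "(\<lambda>n. pi / ln (real n)) \<longlonglongrightarrow> 0"
      by real_asymp
    \<comment> \<open>For \<open>j < k\<close> the scaled moments converge by induction, while a
      positive power of \<open>pi / ln n\<close> remains and tends to 0.\<close>
    then have "(\<lambda>n. \<Sum>j<k. real (stirling k j) * ?E n (\<lambda>x. (pi / ln (real n) * ?L n x) ^ j) * (pi / ln (real n)) ^ (k - j))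
        \<longlonglongrightarrow> (\<Sum>j<k. real (stirling k j) * fact (j + 1) * 0 ^ (k - j))"
      by (intro tendsto_intros less.IH) auto
    also have "(\<Sum>j<k. real (stirling k j) * fact (j + 1) * 0 ^ (k - j)) = 0"
      by (intro sum.neutral) auto
    finally have lower: "(\<lambda>n. \<Sum>j<k. real (stirling k j) * ?E n (\<lambda>x. (pi / ln (real n) * ?L n x) ^ j) * (pi / ln (real n)) ^ (k - j))
        \<longlonglongrightarrow> 0" .
    \<comment> \<open>The rising factorial is expanded in powers with Stirling coefficients. As
      \<open>stirling k k = 1\<close>, the term \<open>j = k\<close> is exactly the scaled
      \<open>k\<close>-th moment.\<close>
    have "?E n (\<lambda>x. pochhammer (?L n x) k) * (pi / ln (real n)) ^ k -
        (\<Sum>j<k. real (stirling k j) * ?E n (\<lambda>x. (pi / ln (real n) * ?L n x) ^ j) * (pi / ln (real n)) ^ (k - j)) =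
        ?E n (\<lambda>x. (pi / ln (real n) * ?L n x) ^ k)" for n
    proof -
      define c where "c = pi / ln (real n)"
      have int: "integrable (measure_pmf (two_srw_bridges n)) f" for f :: "_ \<Rightarrow> real"
        by (rule integrable_measure_pmf_finite)
           (simp add: two_srw_bridges_def finite_srw_bridges srw_bridges_nonempty)
      have "?E n (\<lambda>x. pochhammer (?L n x) k) * c ^ k = ?E n (\<lambda>x. pochhammer (?L n x) k * c ^ k)"
        by simp
      also have "(\<lambda>x. pochhammer (?L n x) k * c ^ k) =
          (\<lambda>x. \<Sum>j\<le>k. real (stirling k j) * (c * ?L n x) ^ j * c ^ (k - j))"
        unfolding stirling_pochhammer[symmetric] sum_distrib_right
        by (intro ext sum.cong refl) (simp add: power_mult_distrib mult_ac flip: power_add)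
      also have "?E n \<dots> = (\<Sum>j\<le>k. real (stirling k j) * ?E n (\<lambda>x. (c * ?L n x) ^ j) * c ^ (k - j))"
        by (subst Bochner_Integration.integral_sum) (auto intro!: int)
      finally show ?thesis
        unfolding c_def[symmetric] by (simp add: lessThan_Suc_atMost[symmetric])
    qed
    with tendsto_diff[OF tendsto_expectation_pochhammer[of k] lower] show ?case
      by simp
  qed
qed

end
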